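(* Consider the relaxed placement problem (A) in the variables $\boldsymbol{\mathcal{V}}\in\mathbb{R}^N$, $\beta\in\mathbb{R}$, $\phi>0$: $$\max_{\boldsymbol{\mathcal{V}},\beta,\phi}\ \frac{\beta}{\phi}$$ subject to $$\mathcal{P}(\boldsymbol{\mathcal{V}})+\mathcal{S}(\mathbf{v}_{\rm prior}\mathbf{v}_{\rm prior}^T,\boldsymbol{\mathcal{I}},\boldsymbol{\mathcal{F}})\succeq\beta\mathbf{I}_{2N},$$ $$\begin{bmatrix}\phi\mathbf{I}_{2N} & \mathbf{M}^{1/2}(\mathbf{I}_{2N}-\mathbf{J}_{\mathcal{V}})\\ (\mathbf{I}_{2N}-\mathbf{J}_{\mathcal{V}})^T(\mathbf{M}^{1/2})^T & \mathbf{I}_{2N}\end{bmatrix}\succeq\mathbf{0},$$ $$\mathcal{P}(\boldsymbol{\mathcal{V}})+\mathcal{S}(\mathbf{v}_{\rm prior}\mathbf{v}_{\rm prior}^T,\boldsymbol{\mathcal{J}}_n,\boldsymbol{\mathcal{F}})\succeq\beta_{\min}\mathbf{I}_{2N}\quad\forall n\in\mathcal{N},$$ $$\mathcal{P}(\boldsymbol{\mathcal{V}})+\mathcal{S}(\mathbf{v}_{\rm prior}\mathbf{v}_{\rm prior}^T,\boldsymbol{\mathcal{I}},\boldsymbol{\mathcal{G}}_{nm})\succeq\beta_{\min}\mathbf{I}_{2N}\quad\forall \{n,m\}\in\mathcal{E},$$ $$\mathbf{J}_{\mathcal{V}}=\mathbf{I}_2\otimes\mathrm{diag}(\boldsymbol{\mathcal{V}}),\quad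 0\le\mathcal{V}_n\le 1\ \ \forall n,\quad \mathbf{1}_N^T\boldsymbol{\mathcal{V}}\le N_{\rm PMU},\quad \boldsymbol{c}^T\boldsymbol{\mathcal{V}}\le C_{\rm PMU}.$$ Consider also the semidefinite program (B) in the variables $\boldsymbol{\xi}\in\mathbb{R}^N$, $\tau\in\mathbb{R}$, $\gamma>0$: $$\max_{\boldsymbol{\xi},\tau,\gamma}\ \tau$$ subject to $$\mathcal{P}(\boldsymbol{\xi})+\gamma\,\mathcal{S}(\mathbf{v}_{\rm prior}\mathbf{v}_{\rm prior}^T,\boldsymbol{\mathcal{I}},\boldsymbol{\mathcal{F}})\succeq\tau\mathbf{I}_{2N},$$ $$\begin{bmatrix}\mathbf{I}_{2N} & \mathbf{M}^{1/2}(\gamma\mathbf{I}_{2N}-\mathbf{I}_{\boldsymbol{\xi}})\\ (\gamma\mathbf{I}_{2N}-\mathbf{I}_{\boldsymbol{\xi}})^T(\mathbf{M}^{1/2})^T & \gamma\mathbf{I}_{2N}\end{bmatrix}\succeq\mathbf{0},$$ $$\mathcal{P}(\boldsymbol{\xi})+\gamma\,\mathcal{S}(\mathbf{v}_{\rm prior}\mathbf{v}_{\rm prior}^T,\boldsymbol{\mathcal{J}}_n,\boldsymbol{\mathcal{F}})\succ\mathbf{0}\quad\forall n\in\mathcal{N},$$ $$\mathcal{P}(\boldsymbol{\xi})+\gamma\,\mathcal{S}(\mathbf{v}_{\rm prior}\mathbf{v}_{\rm prior}^T,\boldsymbol{\mathcal{I}},\boldsymbol{\mathcal{G}}_{nm})\succ\mathbf{0}\quad\forall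 \{n,m\}\in\mathcal{E},$$ $$\mathbf{I}_{\boldsymbol{\xi}}=\mathbf{I}_2\otimes\mathrm{diag}(\boldsymbol{\xi}),\quad \xi_n\in[0,\gamma]\ \ \forall n,\quad \mathbf{1}_N^T\boldsymbol{\xi}\le N_{\rm PMU}\gamma,\quad \boldsymbol{c}^T\boldsymbol{\xi}\le\gamma C_{\rm PMU}.$$ Then, by letting $\gamma=1/\phi$, $\tau=\beta/\phi$ and $\boldsymbol{\xi}=\boldsymbol{\mathcal{V}}/\phi$, the global optimum solution of (A) can be determined by (B): the solution $(\boldsymbol{\xi}^\star,\tau^\star,\gamma^\star)$ of (B) is mapped to the solution of (A) by $\boldsymbol{\mathcal{V}}^\star=\boldsymbol{\xi}^\star/\gamma^\star$.
   Context: Notation: $\mathbf{A}\succeq\mathbf{B}$ (resp. $\mathbf{A}\succ\mathbf{B}$) means the symmetric matrix $\mathbf{A}-\mathbf{B}$ is positive semidefinite (resp. positive definite); $\otimes$ is the Kronecker product; $\mathbf{I}_k$ is the $k\times k$ identity; $\mathbf{e}_n$ is the $n$-th canonical basis vector of $\mathbb{R}^N$; $\mathbf{1}_k$ is the all-ones vector in $\mathbb{R}^k$. Grid. A power grid has bus set $\mathcal{N}=\{1,\dots,N\}$ and line set $\mathcal{E}$ of unordered pairs $\{n,m\}$, $|\mathcal{E}|=L$. $\mathcal{N}(n)=\{m:\{n,m\}\in\mathcal{E}\}$, $L_n=|\mathcal{N}(n)|$. Quantities with index $nm$ are indexed by ordered pairs $(n,m)$ with $\{n,m\}\in\mathcal{E}$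 (line $\{n,m\}$ measured at bus $n$). Each line has complex line admittance $Y_{nm}$ and complex shunt admittance-to-ground $\bar Y_{nm}$; the admittance matrix is $\mathbf{Y}=[-Y_{nm}]_{N\times N}$, with $Y_{nm}=0$ if $n\ne m$ and $\{n,m\}\notin\mathcal{E}$, and $Y_{nn}=-\sum_{m\ne n}(\bar Y_{nm}+Y_{nm})$ (sum over neighbours $m$ of $n$). Matrices. $\mathbf{Y}_n=\mathbf{e}_n\mathbf{e}_n^T\mathbf{Y}$, $\mathbf{Y}_{nm}=(Y_{nm}+\bar Y_{nm})\mathbf{e}_n\mathbf{e}_n^T-Y_{nm}\mathbf{e}_n\mathbf{e}_m^T$ (matrix, as opposed to the scalar $Y_{nm}$). $\mathbf{G}_n,\mathbf{B}_n$ (resp. $\mathbf{G}_{nm},\mathbf{B}_{nm}$) are the real and imaginary parts of $\mathbf{Y}_n$ (resp. $\mathbf{Y}_{nm}$). Define the $2N\times2N$ real matrices $$\mathbf{N}_{P,n}=\begin{bmatrix}\mathbf{G}_n&-\mathbf{B}_n\\ \mathbf{B}_n&\mathbf{G}_n\end{bmatrix},\ \mathbf{N}_{Q,n}=-\begin{bmatrix}\mathbf{B}_n&\mathbf{G}_n\\-\mathbf{G}_n&\mathbf{B}_n\end{bmatrix},\ \mathbf{E}_{P,nm}=\begin{bmatrix}\mathbf{G}_{nm}&-\mathbf{B}_{nm}\\ \mathbf{B}_{nm}&\mathbf{G}_{nm}\end{bmatrix},\ \mathbf{E}_{Q,nm}=-\begin{bmatrix}\mathbf{B}_{nm}&\mathbf{G}_{nm}\\-\mathbf{G}_{nm}&\mathbf{B}_{nm}\end{bmatrix},$$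 $$\mathbf{C}_{I,nm}=\begin{bmatrix}\mathbf{G}_{nm}&\mathbf{0}\\ \mathbf{0}&-\mathbf{B}_{nm}\end{bmatrix},\quad \mathbf{C}_{J,nm}=\begin{bmatrix}\mathbf{B}_{nm}&\mathbf{0}\\ \mathbf{0}&\mathbf{G}_{nm}\end{bmatrix}.$$ With $\mathbf{S}_n=\mathbf{I}_{L_n}\otimes(\mathbf{1}_2\otimes\mathbf{e}_n)^T$, let $\mathbf{H}_{I,n}=\mathbf{S}_n\mathbf{C}_{I,n}$ and $\mathbf{H}_{J,n}=\mathbf{S}_n\mathbf{C}_{J,n}$, where $\mathbf{C}_{I,n}$, $\mathbf{C}_{J,n}$ are $[\cdots,\mathbf{C}_{I,nm}^T,\cdots]^T$, $[\cdots,\mathbf{C}_{J,nm}^T,\cdots]^T$ over $m\in\mathcal{N}(n)$. Placements. $\boldsymbol{\mathcal{V}}=[\mathcal{V}_1,\dots,\mathcal{V}_N]^T$ is the placement vector of the phasor measurement units (PMUs) (binary originally, relaxed here to $[0,1]$). The placement of the conventional (SCADA) measurements is fixed: $\mathcal{I}_n\in\{0,1\}$ indicates that the power injection at bus $n$ is measured, $\mathcal{F}_{nm}\in\{0,1\}$ that the power flow on line $\{n,m\}$ at bus $n$ is measured; $\boldsymbol{\mathcal{I}}=[\mathcal{I}_n]$, $\boldsymbol{\mathcal{F}}=[\mathcal{F}_{nm}]$. $\boldsymbol{\mathcal{J}}_n$ is $\boldsymbol{\mathcal{I}}$ with the injection measurement at bus $n$ removed (entry set to $0$); $\boldsymbol{\mathcal{G}}_{nm}$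 is $\boldsymbol{\mathcal{F}}$ with the flow measurement on line $\{n,m\}$ at bus $n$ removed. Gain matrix components. For given positive noise standard deviations $\sigma_{\mathcal{V}},\sigma_{\mathcal{C}},\sigma_{\mathcal{I}},\sigma_{\mathcal{F}}$ and any vector $\boldsymbol{\mathcal{V}}\in\mathbb{R}^N$, $$\mathcal{P}(\boldsymbol{\mathcal{V}})=\sum_{n=1}^N\mathcal{V}_n\left(\frac{\mathbf{I}_2\otimes\mathbf{e}_n\mathbf{e}_n^T}{\sigma_{\mathcal{V}}^2}+\frac{\mathbf{H}_{I,n}^T\mathbf{H}_{I,n}+\mathbf{H}_{J,n}^T\mathbf{H}_{J,n}}{\sigma_{\mathcal{C}}^2}\right),$$ and, for a symmetric $2N\times 2N$ matrix $\mathbf{V}$, $$\mathcal{S}(\mathbf{V},\boldsymbol{\mathcal{I}},\boldsymbol{\mathcal{F}})=\sum_{n=1}^N\frac{\mathcal{I}_n}{\sigma_{\mathcal{I}}^2}\sum_{X\in\{P,Q\}}(\mathbf{N}_{X,n}+\mathbf{N}_{X,n}^T)^T\mathbf{V}(\mathbf{N}_{X,n}+\mathbf{N}_{X,n}^T)+\sum_{(n,m)}\frac{\mathcal{F}_{nm}}{\sigma_{\mathcal{F}}^2}\sum_{X\in\{P,Q\}}(\mathbf{E}_{X,nm}+\mathbf{E}_{X,nm}^T)^T\mathbf{V}(\mathbf{E}_{X,nm}+\mathbf{E}_{X,nm}^T),$$ the last sum being over ordered pairs with $\{n,m\}\in\mathcal{E}$. $\mathbf{M}=\mathcal{S}(\mathbf{I}_{2N},\boldsymbol{\mathcal{I}},\boldsymbol{\mathcal{F}})$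 (symmetric positive semidefinite), and $\mathbf{M}^{1/2}$ is its square root. Given data: $\mathbf{v}_{\rm prior}\in\mathbb{R}^{2N}$ is a fixed nominal state, $\beta_{\min}>0$ a tolerance parameter, $N_{\rm PMU}$ the PMU budget, $\boldsymbol{c}\in\mathbb{R}^N$ the vector of PMU costs, and $C_{\rm PMU}$ the total cost bound.
   Formalization: For a fixed β_min the claim can fail, since (B) only requires ≻ 0; it is proved when ξ*/γ* satisfies the β_min constraints of (A), and, for each optimum of (B), for all sufficiently small β_min > 0 (threshold depending on that optimum). *)

theory Defs
  imports "HOL-Analysis.Analysis"
begin

definition psd :: "real^'a^'a \<Rightarrow> bool" where
  "psd A \<longleftrightarrow> transpose A = A \<and> (\<forall>x. x \<bullet> (A *v x) \<ge> 0)"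

definition pd :: "real^'a^'a \<Rightarrow> bool" where
  "pd A \<longleftrightarrow> transpose A = A \<and> (\<forall>x. x \<noteq> 0 \<longrightarrow> x \<bullet> (A *v x) > 0)"

definition loewner_ge :: "real^'a^'a \<Rightarrow> real^'a^'a \<Rightarrow> bool" (infix \<open>\<succeq>\<close> 50) where
  "A \<succeq> B \<longleftrightarrow> psd (A - B)"

definition loewner_gt :: "real^'a^'a \<Rightarrow> real^'a^'a \<Rightarrow> bool" (infix \<open>\<succ>\<close> 50) where
  "A \<succ> B \<longleftrightarrow> pd (A - B)"

definition psd_sqrt :: "real^'a^'a \<Rightarrow> real^'a^'a" where
  "psd_sqrt A = (THE R. psd R \<and> R ** R = A)"

definition diag_mat :: "real^'a \<Rightarrow> real^'a^'a" where
  "diag_mat v = (\<chi> i j. if i = j then v $ i else 0)"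

definition kron :: "real^'b^'a \<Rightarrow> real^'d^'c \<Rightarrow> real^('b \<times> 'd)^('a \<times> 'c)" where
  "kron A B = (\<chi> p q. A $ fst p $ fst q * B $ snd p $ snd q)"

definition col :: "real^'a \<Rightarrow> real^1^'a" where
  "col v = columnvector v"

definition outer :: "'k::comm_semiring_1^'a \<Rightarrow> 'k^'b \<Rightarrow> 'k^'b^'a" where
  "outer u v = (\<chi> i j. u $ i * v $ j)"

definition smult_mat :: "'k::times \<Rightarrow> 'k^'b^'a \<Rightarrow> 'k^'b^'a" where
  "smult_mat c A = (\<chi> i j. c * A $ i $ j)"

definition Re_mat :: "complex^'b^'a \<Rightarrow> real^'b^'a" where
  "Re_mat A = (\<chi> i j. Re (A $ i $ j))"

definition Im_mat :: "complex^'b^'a \<Rightarrow> real^'b^'a" where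
  "Im_mat A = (\<chi> i j. Im (A $ i $ j))"

text \<open>A matrix with \<open>2 \<times> 2\<close> blocks is indexed by pairs (block, position in the block);
  the two elements of type \<^typ>\<open>2\<close> are \<open>1\<close> and \<open>2\<close> (with \<open>2 = 0\<close>).  So, for a bus type \<open>'n\<close>
  with \<open>N\<close> elements, \<open>2N\<close>-dimensional space is \<open>real^(2 \<times> 'n)\<close>, consistently with
  \<open>kron\<close>.\<close>

definition block2 ::
  "real^'a^'a \<Rightarrow> real^'a^'a \<Rightarrow> real^'a^'a \<Rightarrow> real^'a^'a \<Rightarrow> real^(2 \<times> 'a)^(2 \<times> 'a)" where
  "block2 A B C D = (\<chi> p q.
     (if fst p = 1 then (if fst q = 1 then A else B) else (if fst q = 1 then C else D))
       $ snd p $ snd q)"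

text \<open>The admittances and the flow placement are functions of ordered pairs of buses; only
  their values at pairs \<open>(n, m)\<close> with \<open>{n, m}\<close> a line matter.\<close>

record 'n pmu_data =
  lines :: "'n set set"
  line_adm :: "'n \<Rightarrow> 'n \<Rightarrow> complex"
  shunt_adm :: "'n \<Rightarrow> 'n \<Rightarrow> complex"
  inj_meas :: "real^'n"
  flow_meas :: "'n \<Rightarrow> 'n \<Rightarrow> real"
  sd_V :: real
  sd_C :: real
  sd_I :: real
  sd_F :: real
  v_prior :: "real^(2 \<times> 'n)"
  n_pmu :: nat
  cost :: "real^'n"
  cost_bound :: real

definition valid_data :: "('n::finite) pmu_data \<Rightarrow> bool" where
  "valid_data D \<longleftrightarrow>
     (\<forall>e\<in>lines D. card e = 2) \<and>
     (\<forall>n. inj_meas D $ n \<in> {0, 1}) \<and>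
     (\<forall>n m. {n, m} \<in> lines D \<longrightarrow> flow_meas D n m \<in> {0, 1}) \<and>
     sd_V D > 0 \<and> sd_C D > 0 \<and> sd_I D > 0 \<and> sd_F D > 0"

definition nbrs :: "('n::finite) pmu_data \<Rightarrow> 'n \<Rightarrow> 'n set" where
  "nbrs D n = {m. {n, m} \<in> lines D}"

definition line_pairs :: "('n::finite) pmu_data \<Rightarrow> ('n \<times> 'n) set" where
  "line_pairs D = {(n, m). {n, m} \<in> lines D}"

definition Y_entry :: "('n::finite) pmu_data \<Rightarrow> 'n \<Rightarrow> 'n \<Rightarrow> complex" where
  "Y_entry D n m =
     (if n = m then - (\<Sum>k\<in>nbrs D n. shunt_adm D n k + line_adm D n k)
      else if {n, m} \<in> lines D then line_adm D n m
      else 0)"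

definition Y_mat :: "('n::finite) pmu_data \<Rightarrow> complex^'n^'n" where
  "Y_mat D = (\<chi> n m. - Y_entry D n m)"

definition Y_bus :: "('n::finite) pmu_data \<Rightarrow> 'n \<Rightarrow> complex^'n^'n" where
  "Y_bus D n = outer (axis n 1) (axis n 1) ** Y_mat D"

definition Y_line :: "('n::finite) pmu_data \<Rightarrow> 'n \<Rightarrow> 'n \<Rightarrow> complex^'n^'n" where
  "Y_line D n m =
     smult_mat (line_adm D n m + shunt_adm D n m) (outer (axis n 1) (axis n 1))
     - smult_mat (line_adm D n m) (outer (axis n 1) (axis m 1))"

definition power_P :: "complex^'n^'n \<Rightarrow> real^(2 \<times> 'n)^(2 \<times> 'n)" where
  "power_P A = block2 (Re_mat A) (- Im_mat A) (Im_mat A) (Re_mat A)"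

definition power_Q :: "complex^'n^'n \<Rightarrow> real^(2 \<times> 'n)^(2 \<times> 'n)" where
  "power_Q A = - block2 (Im_mat A) (Re_mat A) (- Re_mat A) (Im_mat A)"

definition N_P where "N_P D n = power_P (Y_bus D n)"
definition N_Q where "N_Q D n = power_Q (Y_bus D n)"
definition E_P where "E_P D n m = power_P (Y_line D n m)"
definition E_Q where "E_Q D n m = power_Q (Y_line D n m)"

definition C_I :: "('n::finite) pmu_data \<Rightarrow> 'n \<Rightarrow> 'n \<Rightarrow> real^(2 \<times> 'n)^(2 \<times> 'n)" where
  "C_I D n m = block2 (Re_mat (Y_line D n m)) 0 0 (- Im_mat (Y_line D n m))"

definition C_J :: "('n::finite) pmu_data \<Rightarrow> 'n \<Rightarrow> 'n \<Rightarrow> real^(2 \<times> 'n)^(2 \<times> 'n)" where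
  "C_J D n m = block2 (Im_mat (Y_line D n m)) 0 0 (Re_mat (Y_line D n m))"

text \<open>The number \<open>L\<^sub>n\<close> of neighbours depends on \<open>n\<close> and cannot be the size of an index type.
  Stacks over the neighbours of \<open>n\<close> are therefore indexed by all buses \<open>m\<close>, the blocks of
  non-neighbours being zero, and \<open>I\<close> of size \<open>L\<^sub>n\<close> becomes the identity on the neighbours.
  This only adds zero rows to \<open>H_I\<close> and \<open>H_J\<close>, which occur only in \<open>H\<^sup>T H\<close>.\<close>

definition stack_nbrs ::
  "('n::finite) pmu_data \<Rightarrow> 'n \<Rightarrow> ('n \<Rightarrow> real^'b^'a) \<Rightarrow> real^'b^('n \<times> 'a)" where
  "stack_nbrs D n A = (\<chi> p q. if fst p \<in> nbrs D n then A (fst p) $ snd p $ q else 0)"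

definition S_sel :: "('n::finite) pmu_data \<Rightarrow> 'n \<Rightarrow> real^('n \<times> (2 \<times> 'n))^('n \<times> (1 \<times> 1))" where
  "S_sel D n =
     kron (diag_mat (\<chi> m. if m \<in> nbrs D n then 1 else 0))
          (transpose (kron (col (\<chi> i. 1)) (col (axis n 1))))"

definition H_I :: "('n::finite) pmu_data \<Rightarrow> 'n \<Rightarrow> real^(2 \<times> 'n)^('n \<times> (1 \<times> 1))" where
  "H_I D n = S_sel D n ** stack_nbrs D n (C_I D n)"

definition H_J :: "('n::finite) pmu_data \<Rightarrow> 'n \<Rightarrow> real^(2 \<times> 'n)^('n \<times> (1 \<times> 1))" where
  "H_J D n = S_sel D n ** stack_nbrs D n (C_J D n)"

definition P_gain :: "('n::finite) pmu_data \<Rightarrow> real^'n \<Rightarrow> real^(2 \<times> 'n)^(2 \<times> 'n)" where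
  "P_gain D V = (\<Sum>n\<in>UNIV. V $ n *\<^sub>R
     ((1 / (sd_V D)\<^sup>2) *\<^sub>R kron (mat 1 :: real^2^2) (outer (axis n 1) (axis n 1))
      + (1 / (sd_C D)\<^sup>2) *\<^sub>R
          (transpose (H_I D n) ** H_I D n + transpose (H_J D n) ** H_J D n)))"

definition sym_sandwich :: "real^'a^'a \<Rightarrow> real^'a^'a \<Rightarrow> real^'a^'a" where
  "sym_sandwich A W = transpose (A + transpose A) ** W ** (A + transpose A)"

definition S_gain :: "('n::finite) pmu_data \<Rightarrow> real^(2 \<times> 'n)^(2 \<times> 'n) \<Rightarrow> real^'n \<Rightarrow>
    ('n \<Rightarrow> 'n \<Rightarrow> real) \<Rightarrow> real^(2 \<times> 'n)^(2 \<times> 'n)" where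
  "S_gain D W I F =
     (\<Sum>n\<in>UNIV. (I $ n / (sd_I D)\<^sup>2) *\<^sub>R
        (sym_sandwich (N_P D n) W + sym_sandwich (N_Q D n) W))
     + (\<Sum>(n, m)\<in>line_pairs D. (F n m / (sd_F D)\<^sup>2) *\<^sub>R
        (sym_sandwich (E_P D n m) W + sym_sandwich (E_Q D n m) W))"

definition S_prior :: "('n::finite) pmu_data \<Rightarrow> real^'n \<Rightarrow> ('n \<Rightarrow> 'n \<Rightarrow> real) \<Rightarrow>
    real^(2 \<times> 'n)^(2 \<times> 'n)" where
  "S_prior D I F = S_gain D (outer (v_prior D) (v_prior D)) I F"

definition M_mat :: "('n::finite) pmu_data \<Rightarrow> real^(2 \<times> 'n)^(2 \<times> 'n)" where
  "M_mat D = S_gain D (mat 1) (inj_meas D) (flow_meas D)"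

definition inj_without :: "('n::finite) pmu_data \<Rightarrow> 'n \<Rightarrow> real^'n" where
  "inj_without D n = (\<chi> k. if k = n then 0 else inj_meas D $ k)"

definition flow_without :: "('n::finite) pmu_data \<Rightarrow> 'n \<Rightarrow> 'n \<Rightarrow> ('n \<Rightarrow> 'n \<Rightarrow> real)" where
  "flow_without D n m = (\<lambda>k l. if k = n \<and> l = m then 0 else flow_meas D k l)"

definition dup_diag :: "real^'n \<Rightarrow> real^(2 \<times> 'n)^(2 \<times> 'n)" where
  "dup_diag V = kron (mat 1 :: real^2^2) (diag_mat V)"

text \<open>The constraints of (A) that involve the tolerance \<open>beta_min\<close>.  Their counterparts in (B)
  are strict and free of \<open>beta_min\<close>: they only say that, after rescaling, these constraints hold
  for some positive tolerance.  So for one fixed \<open>beta_min\<close> the feasible set of (B) is larger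
  than the image of that of (A), and an optimum of (B) need not be feasible for (A) unless
  \<open>beta_min\<close> is small enough.\<close>

definition contingency_ok :: "('n::finite) pmu_data \<Rightarrow> real \<Rightarrow> real^'n \<Rightarrow> bool" where
  "contingency_ok D beta_min V \<longleftrightarrow>
     (\<forall>n. P_gain D V + S_prior D (inj_without D n) (flow_meas D) \<succeq> beta_min *\<^sub>R mat 1) \<and>
     (\<forall>(n, m)\<in>line_pairs D.
        P_gain D V + S_prior D (inj_meas D) (flow_without D n m) \<succeq> beta_min *\<^sub>R mat 1)"

definition feasible_A :: "('n::finite) pmu_data \<Rightarrow> real \<Rightarrow> real^'n \<Rightarrow> real \<Rightarrow> real \<Rightarrow> bool" where
  "feasible_A D beta_min V \<beta> \<phi> \<longleftrightarrow>
     \<phi> > 0 \<and>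
     P_gain D V + S_prior D (inj_meas D) (flow_meas D) \<succeq> \<beta> *\<^sub>R mat 1 \<and>
     block2 (\<phi> *\<^sub>R mat 1) (psd_sqrt (M_mat D) ** (mat 1 - dup_diag V))
            (transpose (mat 1 - dup_diag V) ** transpose (psd_sqrt (M_mat D))) (mat 1) \<succeq> 0 \<and>
     contingency_ok D beta_min V \<and>
     (\<forall>n. 0 \<le> V $ n \<and> V $ n \<le> 1) \<and>
     (\<chi> n. 1) \<bullet> V \<le> real (n_pmu D) \<and>
     cost D \<bullet> V \<le> cost_bound D"

definition solves_A :: "('n::finite) pmu_data \<Rightarrow> real \<Rightarrow> real^'n \<Rightarrow> real \<Rightarrow> real \<Rightarrow> bool" where
  "solves_A D beta_min V \<beta> \<phi> \<longleftrightarrow>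
     feasible_A D beta_min V \<beta> \<phi> \<and>
     (\<forall>V' \<beta>' \<phi>'. feasible_A D beta_min V' \<beta>' \<phi>' \<longrightarrow> \<beta>' / \<phi>' \<le> \<beta> / \<phi>)"

definition feasible_B :: "('n::finite) pmu_data \<Rightarrow> real^'n \<Rightarrow> real \<Rightarrow> real \<Rightarrow> bool" where
  "feasible_B D \<xi> \<tau> \<gamma> \<longleftrightarrow>
     \<gamma> > 0 \<and>
     P_gain D \<xi> + \<gamma> *\<^sub>R S_prior D (inj_meas D) (flow_meas D) \<succeq> \<tau> *\<^sub>R mat 1 \<and>
     block2 (mat 1) (psd_sqrt (M_mat D) ** (\<gamma> *\<^sub>R mat 1 - dup_diag \<xi>))
            (transpose (\<gamma> *\<^sub>R mat 1 - dup_diag \<xi>) ** transpose (psd_sqrt (M_mat D)))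
            (\<gamma> *\<^sub>R mat 1) \<succeq> 0 \<and>
     (\<forall>n. P_gain D \<xi> + \<gamma> *\<^sub>R S_prior D (inj_without D n) (flow_meas D) \<succ> 0) \<and>
     (\<forall>(n, m)\<in>line_pairs D.
        P_gain D \<xi> + \<gamma> *\<^sub>R S_prior D (inj_meas D) (flow_without D n m) \<succ> 0) \<and>
     (\<forall>n. \<xi> $ n \<in> {0..\<gamma>}) \<and>
     (\<chi> n. 1) \<bullet> \<xi> \<le> real (n_pmu D) * \<gamma> \<and>
     cost D \<bullet> \<xi> \<le> \<gamma> * cost_bound D"

definition solves_B :: "('n::finite) pmu_data \<Rightarrow> real^'n \<Rightarrow> real \<Rightarrow> real \<Rightarrow> bool" where
  "solves_B D \<xi> \<tau> \<gamma> \<longleftrightarrow>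
     feasible_B D \<xi> \<tau> \<gamma> \<and>
     (\<forall>\<xi>' \<tau>' \<gamma>'. feasible_B D \<xi>' \<tau>' \<gamma>' \<longrightarrow> \<tau>' \<le> \<tau>)"

end

theory Submission
  imports Defs
begin

text \<open>
  The substitution \<open>\<gamma> = 1 / \<phi>\<close>, \<open>\<tau> = \<beta> / \<phi>\<close>, \<open>\<xi> = V / \<phi>\<close> multiplies both sides of every constraint
  of (A) by the positive number \<open>\<gamma>\<close>.  Indeed \<open>P_gain\<close> and \<open>dup_diag\<close> are homogeneous in the
  placement, and since \<open>\<gamma> \<phi> = 1\<close> even the block matrix of (B) is exactly \<open>\<gamma>\<close> times that of (A).
  The Loewner order is invariant under positive scaling, so, apart from the contingency
  constraints, a point satisfies (A) exactly when its image satisfies (B)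
  (\<open>feasible_B_scaleR_iff\<close>), and the objective \<open>\<beta> / \<phi>\<close> becomes \<open>\<tau>\<close>.

  In the contingency constraints (B) replaces the tolerance \<open>beta_min\<close> by strict definiteness.
  The former implies the latter, so (B) is a relaxation of (A), and an optimum of (B) that meets
  the tolerance is an optimum of (A).  Conversely, a positive definite matrix dominates \<open>b I\<close> for
  all sufficiently small \<open>b > 0\<close>, by compactness of the unit sphere
  (\<open>loewner_gt_0_imp_ge_mat_1\<close>).  A given optimum of (B) involves only finitely many contingency
  matrices, so it meets every tolerance below a common threshold.
\<close>

lemma psd_scaleR_iff:
  assumes "c > 0"
  shows "psd (c *\<^sub>R A) \<longleftrightarrow> psd A"
  using assms
  by (simp add: psd_def scaleR_matrix_vector_assoc[symmetric] transpose_scalar zero_le_mult_iff)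

lemma pd_scaleR_iff:
  assumes "c > 0"
  shows "pd (c *\<^sub>R A) \<longleftrightarrow> pd A"
  using assms
  by (simp add: pd_def scaleR_matrix_vector_assoc[symmetric] transpose_scalar zero_less_mult_iff)

lemma loewner_ge_scaleR_iff:
  assumes "c > 0"
  shows "c *\<^sub>R A \<succeq> c *\<^sub>R B \<longleftrightarrow> A \<succeq> B"
  using psd_scaleR_iff[OF assms, of "A - B"] by (simp add: loewner_ge_def scaleR_diff_right)

lemma loewner_gt_0_scaleR_iff:
  assumes "c > 0"
  shows "c *\<^sub>R A \<succ> 0 \<longleftrightarrow> A \<succ> 0"
  using pd_scaleR_iff[OF assms, of A] by (simp add: loewner_gt_def)

lemma transpose_diff: "transpose (A - B) = transpose A - transpose (B :: real^'a^'b)"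
  by (simp add: transpose_def vec_eq_iff)

lemma loewner_ge_scaleR_mat_1_iff:
  "A \<succeq> b *\<^sub>R mat 1 \<longleftrightarrow> transpose A = A \<and> (\<forall>x. b * (x \<bullet> x) \<le> x \<bullet> (A *v x))"
  by (simp add: loewner_ge_def psd_def transpose_diff transpose_scalar inner_diff_right
      matrix_vector_mult_diff_rdistrib scaleR_matrix_vector_assoc[symmetric])

lemma loewner_ge_mat_1_imp_gt_0:
  assumes "b > 0" and "A \<succeq> b *\<^sub>R mat 1"
  shows "A \<succ> 0"
proof -
  have "x \<bullet> (A *v x) > 0" if "x \<noteq> 0" for x
  proof -
    have "0 < b * (x \<bullet> x)" using assms(1) that by simp
    also have "\<dots> \<le> x \<bullet> (A *v x)" using assms(2) by (simp add: loewner_ge_scaleR_mat_1_iff)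
    finally show ?thesis .
  qed
  then show ?thesis using assms(2) by (simp add: loewner_gt_def pd_def loewner_ge_scaleR_mat_1_iff)
qed

text \<open>The threshold is the minimum of the quadratic form over the unit sphere, which is attained
  and hence positive; by homogeneity it is a lower bound for the Rayleigh quotient.\<close>

lemma loewner_gt_0_imp_ge_mat_1:
  fixes A :: "real^'a^'a"
  assumes "A \<succ> 0"
  shows "\<exists>c>0. A \<succeq> c *\<^sub>R mat 1"
proof -
  let ?q = "\<lambda>x. x \<bullet> (A *v x)"
  have pd: "transpose A = A" "x \<noteq> 0 \<Longrightarrow> ?q x > 0" for x
    using assms by (simp_all add: loewner_gt_def pd_def)
  have "continuous_on (sphere 0 1) ?q"
    by (intro continuous_on_inner continuous_on_id matrix_vector_mult_linear_continuous_on)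
  moreover have "sphere (0 :: real^'a) 1 \<noteq> {}" by simp
  ultimately obtain u where u: "u \<in> sphere 0 1" and min: "x \<in> sphere 0 1 \<Longrightarrow> ?q u \<le> ?q x" for x
    using continuous_attains_inf[OF compact_sphere] by blast
  have "?q u * (x \<bullet> x) \<le> ?q x" for x
  proof (cases "x = 0")
    case False
    have "?q u \<le> ?q ((1 / norm x) *\<^sub>R x)" using False by (intro min) simp
    also have "\<dots> = ?q x / (norm x)\<^sup>2"
      by (simp add: matrix_vector_mult_scaleR power2_eq_square)
    finally show ?thesis using False by (simp add: field_simps power2_norm_eq_inner)
  qed simp
  moreover have "?q u > 0" using u by (intro pd) auto
  ultimately show ?thesis using pd(1) by (auto simp: loewner_ge_scaleR_mat_1_iff)
qed

lemma loewner_ge_mat_1_mono: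
  assumes "A \<succeq> c *\<^sub>R mat 1" and "b \<le> c"
  shows "A \<succeq> b *\<^sub>R mat 1"
  using assms unfolding loewner_ge_scaleR_mat_1_iff
  by (meson inner_ge_zero mult_right_mono order_trans)

text \<open>Phrased with a filter, so that the thresholds of finitely many matrices combine.\<close>

lemma eventually_loewner_ge_mat_1:
  assumes "A \<succ> 0"
  shows "\<forall>\<^sub>F b in at_right 0. A \<succeq> b *\<^sub>R mat 1"
proof -
  obtain c where "c > 0" "A \<succeq> c *\<^sub>R mat 1"
    using loewner_gt_0_imp_ge_mat_1[OF assms] by blast
  then show ?thesis
    by (auto simp: eventually_at_right intro!: exI[of _ c] intro: loewner_ge_mat_1_mono)
qed

lemma P_gain_scaleR: "P_gain D (c *\<^sub>R V) = c *\<^sub>R P_gain D V"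
  by (simp add: P_gain_def scaleR_sum_right)

lemma dup_diag_scaleR: "dup_diag (c *\<^sub>R V) = c *\<^sub>R dup_diag V"
  by (simp add: dup_diag_def kron_def diag_mat_def vec_eq_iff)

lemma block2_scaleR: "block2 (c *\<^sub>R A) (c *\<^sub>R B) (c *\<^sub>R C) (c *\<^sub>R E) = c *\<^sub>R block2 A B C E"
  by (simp add: block2_def vec_eq_iff)

lemma contingency_ok_imp_gt_0:
  assumes "contingency_ok D b V" and "b > 0"
  shows "P_gain D V + S_prior D (inj_without D n) (flow_meas D) \<succ> 0"
    and "(n, m) \<in> line_pairs D \<Longrightarrow> P_gain D V + S_prior D (inj_meas D) (flow_without D n m) \<succ> 0"
  using assms loewner_ge_mat_1_imp_gt_0[OF assms(2)] unfolding contingency_ok_def by blast+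

text \<open>Scaling by \<open>\<gamma>\<close> pulled out of every constraint of (B): what is left are the constraints of (A)
  with \<open>\<phi> = 1 / \<gamma>\<close>, except that the contingency constraints ask for strict definiteness only.\<close>

lemma feasible_B_scaleR_iff:
  assumes "\<gamma> > 0"
  shows "feasible_B D (\<gamma> *\<^sub>R V) (\<gamma> * \<beta>) \<gamma> \<longleftrightarrow>
     P_gain D V + S_prior D (inj_meas D) (flow_meas D) \<succeq> \<beta> *\<^sub>R mat 1 \<and>
     block2 ((1 / \<gamma>) *\<^sub>R mat 1) (psd_sqrt (M_mat D) ** (mat 1 - dup_diag V))
            (transpose (mat 1 - dup_diag V) ** transpose (psd_sqrt (M_mat D))) (mat 1) \<succeq> 0 \<and>
     (\<forall>n. P_gain D V + S_prior D (inj_without D n) (flow_meas D) \<succ> 0) \<and>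
     (\<forall>(n, m)\<in>line_pairs D.
        P_gain D V + S_prior D (inj_meas D) (flow_without D n m) \<succ> 0) \<and>
     (\<forall>n. 0 \<le> V $ n \<and> V $ n \<le> 1) \<and>
     (\<chi> n. 1) \<bullet> V \<le> real (n_pmu D) \<and>
     cost D \<bullet> V \<le> cost_bound D"
proof -
  let ?R = "psd_sqrt (M_mat D)"
  have gain: "P_gain D (\<gamma> *\<^sub>R V) + \<gamma> *\<^sub>R S = \<gamma> *\<^sub>R (P_gain D V + S)" for S
    by (simp add: P_gain_scaleR scaleR_add_right)
  have ge: "\<gamma> *\<^sub>R A \<succeq> (\<gamma> * \<beta>) *\<^sub>R mat 1 \<longleftrightarrow> A \<succeq> \<beta> *\<^sub>R mat 1" for A :: "real^(2 \<times> 'a)^(2 \<times> 'a)"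
    using loewner_ge_scaleR_iff[OF assms, of A "\<beta> *\<^sub>R mat 1"] by simp
  have J: "\<gamma> *\<^sub>R mat 1 - dup_diag (\<gamma> *\<^sub>R V) = \<gamma> *\<^sub>R (mat 1 - dup_diag V)"
    by (simp add: dup_diag_scaleR scaleR_diff_right)
  have block: "block2 (mat 1) (?R ** (\<gamma> *\<^sub>R mat 1 - dup_diag (\<gamma> *\<^sub>R V)))
      (transpose (\<gamma> *\<^sub>R mat 1 - dup_diag (\<gamma> *\<^sub>R V)) ** transpose ?R) (\<gamma> *\<^sub>R mat 1)
    = \<gamma> *\<^sub>R block2 ((1 / \<gamma>) *\<^sub>R mat 1) (?R ** (mat 1 - dup_diag V))
        (transpose (mat 1 - dup_diag V) ** transpose ?R) (mat 1)"
    using assms unfolding J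
    by (simp add: block2_scaleR[symmetric] transpose_scalar matrix_scalar_ac
        scalar_matrix_assoc)
  have ge0: "\<gamma> *\<^sub>R A \<succeq> 0 \<longleftrightarrow> A \<succeq> 0" for A :: "real^(2 \<times> (2 \<times> 'a))^(2 \<times> (2 \<times> 'a))"
    using loewner_ge_scaleR_iff[OF assms, of A 0] by simp
  show ?thesis
    unfolding feasible_B_def gain ge block ge0 loewner_gt_0_scaleR_iff[OF assms]
    using assms by (simp add: zero_le_mult_iff mult.commute)
qed

text \<open>For \<open>\<phi> \<le> 0\<close> both sides fail, because then \<open>1 / \<phi> \<le> 0\<close>, with \<open>1 / 0 = 0\<close> as default value.\<close>

lemma feasible_A_iff_feasible_B:
  assumes "b > 0"
  shows "feasible_A D b V \<beta> \<phi> \<longleftrightarrow>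
    feasible_B D ((1 / \<phi>) *\<^sub>R V) (\<beta> / \<phi>) (1 / \<phi>) \<and> contingency_ok D b V"
proof (cases "\<phi> > 0")
  case True
  then show ?thesis
    using feasible_B_scaleR_iff[of "1 / \<phi>" D V \<beta>] contingency_ok_imp_gt_0[of D b V] assms
    by (auto simp: feasible_A_def)
qed (simp add: feasible_A_def feasible_B_def)

text \<open>Every point feasible for (A) has an image feasible for (B) with the same objective value, so the
  optimal value of (B) bounds that of (A); the optimum of (B) attains this bound as soon as it
  meets the tolerance.\<close>

lemma solves_B_imp_solves_A:
  assumes b: "b > 0" and B: "solves_B D \<xi> \<tau> \<gamma>" and ok: "contingency_ok D b ((1 / \<gamma>) *\<^sub>R \<xi>)"
  shows "solves_A D b ((1 / \<gamma>) *\<^sub>R \<xi>) (\<tau> / \<gamma>) (1 / \<gamma>)"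
proof -
  have "\<gamma> > 0" using B by (simp add: solves_B_def feasible_B_def)
  then show ?thesis
    using B ok unfolding solves_A_def solves_B_def feasible_A_iff_feasible_B[OF b] by auto
qed

lemma feasible_B_imp_eventually_contingency_ok:
  assumes "feasible_B D \<xi> \<tau> \<gamma>"
  shows "\<forall>\<^sub>F b in at_right 0. contingency_ok D b ((1 / \<gamma>) *\<^sub>R \<xi>)"
proof -
  have "\<gamma> > 0" using assms by (simp add: feasible_B_def)
  then have pos:
    "P_gain D ((1 / \<gamma>) *\<^sub>R \<xi>) + S_prior D (inj_without D n) (flow_meas D) \<succ> 0"
    "(n, m) \<in> line_pairs D \<Longrightarrow>
      P_gain D ((1 / \<gamma>) *\<^sub>R \<xi>) + S_prior D (inj_meas D) (flow_without D n m) \<succ> 0" for n m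
    using feasible_B_scaleR_iff[of \<gamma> D "(1 / \<gamma>) *\<^sub>R \<xi>" "\<tau> / \<gamma>"] assms by auto
  show ?thesis
    unfolding contingency_ok_def
    by (intro eventually_conj eventually_all_finite eventually_ball_finite ballI)
      (auto intro: eventually_loewner_ge_mat_1 pos simp del: scaleR_scaleR)
qed

theorem proposition2:
  fixes D :: "('n::finite) pmu_data" and beta_min :: real
  assumes "valid_data D" and "beta_min > 0"
  shows
    "(\<forall>V \<beta> \<phi>. feasible_A D beta_min V \<beta> \<phi> \<longleftrightarrow>
        feasible_B D ((1 / \<phi>) *\<^sub>R V) (\<beta> / \<phi>) (1 / \<phi>) \<and> contingency_ok D beta_min V)
     \<and>
     (\<forall>\<xi> \<tau> \<gamma>. solves_B D \<xi> \<tau> \<gamma> \<and> contingency_ok D beta_min ((1 / \<gamma>) *\<^sub>R \<xi>) \<longrightarrow>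
        solves_A D beta_min ((1 / \<gamma>) *\<^sub>R \<xi>) (\<tau> / \<gamma>) (1 / \<gamma>))
     \<and>
     (\<forall>\<xi> \<tau> \<gamma>. solves_B D \<xi> \<tau> \<gamma> \<longrightarrow>
        (\<exists>b0 > 0. \<forall>b. 0 < b \<and> b \<le> b0 \<longrightarrow>
           solves_A D b ((1 / \<gamma>) *\<^sub>R \<xi>) (\<tau> / \<gamma>) (1 / \<gamma>)))"
proof (intro conjI allI impI)
  fix V \<beta> \<phi>
  show "feasible_A D beta_min V \<beta> \<phi> \<longleftrightarrow>
      feasible_B D ((1 / \<phi>) *\<^sub>R V) (\<beta> / \<phi>) (1 / \<phi>) \<and> contingency_ok D beta_min V"
    by (rule feasible_A_iff_feasible_B[OF assms(2)])
next
  fix \<xi> \<tau> \<gamma>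
  assume "solves_B D \<xi> \<tau> \<gamma> \<and> contingency_ok D beta_min ((1 / \<gamma>) *\<^sub>R \<xi>)"
  then show "solves_A D beta_min ((1 / \<gamma>) *\<^sub>R \<xi>) (\<tau> / \<gamma>) (1 / \<gamma>)"
    using solves_B_imp_solves_A[OF assms(2)] by blast
next
  fix \<xi> \<tau> \<gamma>
  assume B: "solves_B D \<xi> \<tau> \<gamma>"
  then have "feasible_B D \<xi> \<tau> \<gamma>" by (simp add: solves_B_def)
  then have "\<forall>\<^sub>F b in at_right 0. contingency_ok D b ((1 / \<gamma>) *\<^sub>R \<xi>)"
    by (rule feasible_B_imp_eventually_contingency_ok)
  then obtain c where "c > 0" and c: "0 < b \<Longrightarrow> b < c \<Longrightarrow> contingency_ok D b ((1 / \<gamma>) *\<^sub>R \<xi>)" for b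
    by (auto simp: eventually_at_right_field)
  \<comment> \<open>The filter provides an open interval; halving its end turns \<open>b < c\<close> into \<open>b \<le> c / 2\<close>.\<close>
  have "solves_A D b ((1 / \<gamma>) *\<^sub>R \<xi>) (\<tau> / \<gamma>) (1 / \<gamma>)" if "0 < b" "b \<le> c / 2" for b
    using that \<open>c > 0\<close> by (intro solves_B_imp_solves_A B c) auto
  then show "\<exists>b0>0. \<forall>b. 0 < b \<and> b \<le> b0 \<longrightarrow> solves_A D b ((1 / \<gamma>) *\<^sub>R \<xi>) (\<tau> / \<gamma>) (1 / \<gamma>)"
    using \<open>c > 0\<close> by (intro exI[of _ "c / 2"]) simp
qed

end
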